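(* Let $\alpha<0$ and let $(\gamma_t)$ be a closed immersed solution to the curve shortening flow on the unit sphere $S^2$, defined on the time interval $[\alpha,0)$, with $\kappa>0$. Then for all $t\in(\alpha,0)$, at every point of $\gamma_t$, $$(\log \kappa)_{ss}+\kappa^2+\frac{1}{2(t-\alpha)}\ \ge\ 0 .$$
   Context: $S^2$ is the round unit sphere. A closed immersed solution to the curve shortening flow is a smooth family of smooth immersions $F_t:S^1\to S^2$ with $\gamma_t=F_t(S^1)$ and $\partial_tF_t=\kappa\nu$, where $\nu$ is a smooth unit normal field along $F_t$ (smooth in $t$), $\tau$ is the unit tangent, and $\kappa$ is the geodesic curvature, defined by $\nabla_\tau\tau=\kappa\nu$. The subscript $s$ denotes differentiation with respect to the arc-length parameter $s=s_t$ of $\gamma_t$. *)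

theory Defs
  imports "HOL-Analysis.Analysis"
begin

section \<open>Smooth maps\<close>

text \<open>
  The set \<open>S\<close> need not be open, but derivatives within \<open>S\<close> should be unique. For
  \<open>S = {\<alpha>..<0} \<times> UNIV\<close> the derivatives at the boundary \<open>t = \<alpha>\<close> are one-sided in time,
  so smoothness on \<open>S\<close> means smoothness up to the initial time.
\<close>

primrec C_k_on :: "nat \<Rightarrow> ('a::real_normed_vector \<Rightarrow> 'b::real_normed_vector) \<Rightarrow> 'a set \<Rightarrow> bool" where
  "C_k_on 0 f S \<longleftrightarrow> continuous_on S f"
| "C_k_on (Suc k) f S \<longleftrightarrow>
     (\<exists>f'. (\<forall>x\<in>S. (f has_derivative f' x) (at x within S)) \<and> (\<forall>v. C_k_on k (\<lambda>x. f' x v) S))"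

definition smooth_on :: "'a::real_normed_vector set \<Rightarrow> ('a \<Rightarrow> 'b::real_normed_vector) \<Rightarrow> bool" where
  "smooth_on S f \<longleftrightarrow> (\<forall>k. C_k_on k f S)"


section \<open>Immersed curves on the unit sphere\<close>

text \<open>
  The circle is \<open>\<real> / 2\<pi>\<int>\<close>: maps on it are \<open>2\<pi>\<close>-periodic functions of a real parameter \<open>u\<close>.
  For an immersed curve \<open>X\<close>, an arc-length parameter is \<open>s(u) = \<integral> \<bar>X'\<bar>\<close>, hence
  \<open>\<partial>\<^sub>s = \<bar>X'\<bar>\<^sup>-\<^sup>1 \<partial>\<^sub>u\<close>.
\<close>

definition arclength_deriv ::
    "(real \<Rightarrow> real^3) \<Rightarrow> (real \<Rightarrow> 'a::real_normed_vector) \<Rightarrow> real \<Rightarrow> 'a" where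
  "arclength_deriv X g u =
     vector_derivative g (at u) /\<^sub>R norm (vector_derivative X (at u))"

definition unit_tangent :: "(real \<Rightarrow> real^3) \<Rightarrow> real \<Rightarrow> real^3" where
  "unit_tangent X = arclength_deriv X X"

text \<open>
  The Levi-Civita connection of the unit sphere is the tangential part of the Euclidean
  derivative, and the outer normal of the sphere at the point \<open>X u\<close> is \<open>X u\<close> itself.
  The following is \<open>\<nabla>\<^sub>\<tau> V\<close> for a vector field \<open>V\<close> along \<open>X\<close>.
\<close>

definition sphere_cov_deriv :: "(real \<Rightarrow> real^3) \<Rightarrow> (real \<Rightarrow> real^3) \<Rightarrow> real \<Rightarrow> real^3" where
  "sphere_cov_deriv X V u =
     arclength_deriv X V u - (arclength_deriv X V u \<bullet> X u) *\<^sub>R X u"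

text \<open>
  \<open>N\<close> is a unit normal field along \<open>X\<close>. For smooth immersed \<open>X\<close> on the sphere, the number
  exists because \<open>\<nabla>\<^sub>\<tau> \<tau>\<close> is tangent to the sphere and orthogonal to \<open>\<tau>\<close>.
\<close>

definition geodesic_curvature :: "(real \<Rightarrow> real^3) \<Rightarrow> (real \<Rightarrow> real^3) \<Rightarrow> real \<Rightarrow> real" where
  "geodesic_curvature X N u =
     (THE k. sphere_cov_deriv X (unit_tangent X) u = k *\<^sub>R N u)"

lemma geodesic_curvature_eqI:
  assumes "sphere_cov_deriv X (unit_tangent X) u = k *\<^sub>R N u" and "norm (N u) = 1"
  shows "geodesic_curvature X N u = k"
  unfolding geodesic_curvature_def using assms by (intro the_equality) auto


section \<open>Curve shortening flow\<close>

definition closed_immersed_family :: "real set \<Rightarrow> (real \<Rightarrow> real \<Rightarrow> real^3) \<Rightarrow> bool" where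
  "closed_immersed_family I F \<longleftrightarrow>
     smooth_on (I \<times> UNIV) (\<lambda>(t, u). F t u) \<and>
     (\<forall>t\<in>I. \<forall>u. F t u \<in> sphere 0 1 \<and>
                 F t (u + 2 * pi) = F t u \<and>
                 vector_derivative (F t) (at u) \<noteq> 0)"

definition unit_normal_field ::
    "real set \<Rightarrow> (real \<Rightarrow> real \<Rightarrow> real^3) \<Rightarrow> (real \<Rightarrow> real \<Rightarrow> real^3) \<Rightarrow> bool" where
  "unit_normal_field I F \<nu> \<longleftrightarrow>
     smooth_on (I \<times> UNIV) (\<lambda>(t, u). \<nu> t u) \<and>
     (\<forall>t\<in>I. \<forall>u. \<nu> t (u + 2 * pi) = \<nu> t u \<and>
                 norm (\<nu> t u) = 1 \<and>
                 \<nu> t u \<bullet> F t u = 0 \<and>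
                 \<nu> t u \<bullet> unit_tangent (F t) u = 0)"

definition closed_immersed_CSF ::
    "real set \<Rightarrow> (real \<Rightarrow> real \<Rightarrow> real^3) \<Rightarrow> (real \<Rightarrow> real \<Rightarrow> real^3) \<Rightarrow> bool" where
  "closed_immersed_CSF I F \<nu> \<longleftrightarrow>
     closed_immersed_family I F \<and>
     unit_normal_field I F \<nu> \<and>
     (\<forall>t\<in>I. \<forall>u. ((\<lambda>r. F r u) has_vector_derivative
                    geodesic_curvature (F t) (\<nu> t) u *\<^sub>R \<nu> t u) (at t within I))"

end

theory Submission
  imports Defs
begin

text \<open>
  Let \<open>w = ln \<kappa>\<close> and \<open>Q = w\<^sub>s\<^sub>s + \<kappa>\<^sup>2\<close>. Along the flow the speed \<open>v = \<bar>F\<^sub>u\<bar>\<close> satisfies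
  \<open>v\<^sub>t = - \<kappa>\<^sup>2 v\<close>, so that \<open>\<partial>\<^sub>t \<partial>\<^sub>s = \<partial>\<^sub>s \<partial>\<^sub>t + \<kappa>\<^sup>2 \<partial>\<^sub>s\<close>, and the curvature satisfies
  \<open>\<kappa>\<^sub>t = \<kappa>\<^sub>s\<^sub>s + \<kappa>\<^sup>3 + \<kappa>\<close>; the last term is the Gauss curvature of the sphere times \<open>\<kappa>\<close>.
  Hence \<open>w\<^sub>t = Q + w\<^sub>s\<^sup>2 + 1\<close>, and a computation turns this into
  \<open>Q\<^sub>t = Q\<^sub>s\<^sub>s + 2 w\<^sub>s Q\<^sub>s + 2 Q\<^sup>2 + 2 \<kappa>\<^sup>2\<close> (lemma \<open>Q_evolution\<close>).

  The function \<open>- 1 / (2 (t - a))\<close> solves the ordinary differential equation \<open>y' = 2 y\<^sup>2\<close> and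
  starts from \<open>- \<infinity>\<close> at time \<open>a\<close>, and the term \<open>2 \<kappa>\<^sup>2 > 0\<close> only pushes \<open>Q\<close> upwards, so the minimum
  principle gives \<open>Q > - 1 / (2 (t - a))\<close>. To avoid the singular initial value, the principle
  (lemma \<open>periodic_positivity_persists\<close>) is applied to \<open>R = (t - a) Q + 1/2\<close>, which equals \<open>1/2\<close>
  at time \<open>a\<close>. At a first zero of \<open>R\<close> the function \<open>Q\<close> has a spatial minimum, so \<open>Q\<^sub>s = 0 \<le> Q\<^sub>s\<^sub>s\<close>,
  and the evolution equation forces \<open>R\<^sub>t > 0\<close>, whereas a first zero requires \<open>R\<^sub>t \<le> 0\<close> (lemma
  \<open>Q_Harnack\<close>). All of this takes place on the open time interval \<open>(\<alpha>, 0)\<close> with an arbitrary start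
  \<open>a > \<alpha>\<close>; letting \<open>a\<close> decrease to \<open>\<alpha>\<close> gives the theorem and avoids one-sided time derivatives.

  The two evolution equations come from the moving frame \<open>F\<close>, \<open>F\<^sub>u\<close>, \<open>\<nu>\<close>, which is an orthogonal basis
  of \<open>\<real>\<^sup>3\<close>. Its equations are \<open>\<nu>\<^sub>u = - \<kappa> F\<^sub>u\<close> and \<open>F\<^sub>u\<^sub>u = - v\<^sup>2 F + (v\<^sub>u / v) F\<^sub>u + \<kappa> v\<^sup>2 \<nu>\<close>. Exchanging
  the partial derivatives in \<open>F\<^sub>t\<^sub>u\<close> gives \<open>v\<^sub>t\<close> (lemma \<open>Dt_v\<close>), and differentiating
  \<open>\<kappa> v\<^sup>2 = F\<^sub>u\<^sub>u \<bullet> \<nu>\<close> in time gives \<open>\<kappa>\<^sub>t\<close> (lemma \<open>Dt_k\<close>).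
\<close>

section \<open>Smooth functions are closed under the operations of the calculus\<close>

lemma C_k_on_subset: "C_k_on k f S \<Longrightarrow> T \<subseteq> S \<Longrightarrow> C_k_on k f T"
proof (induction k arbitrary: f)
  case (Suc k)
  then obtain f' where f': "\<forall>x\<in>S. (f has_derivative f' x) (at x within S)"
      "\<forall>v. C_k_on k (\<lambda>x. f' x v) S"
    by auto
  then show ?case
    using Suc.IH[OF _ Suc.prems(2)] has_derivative_subset[OF _ Suc.prems(2)] Suc.prems(2)
    by (simp, intro exI[of _ f']) blast
qed (auto intro: continuous_on_subset)

text \<open>
  The definition of \<open>C_k_on\<close> leaves values outside \<open>S\<close> unconstrained, so functions such as the
  curvature, for which a formula is available only at times of the flow, inherit smoothness from it.
\<close>

lemma C_k_on_cong_imp: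
  assumes "C_k_on k f S" and "\<And>x. x \<in> S \<Longrightarrow> f x = g x"
  shows "C_k_on k g S"
proof (cases k)
  case 0
  then show ?thesis using assms continuous_on_cong[of S S f g] by auto
next
  case (Suc m)
  then show ?thesis
    using assms by simp (metis has_derivative_transform)
qed

lemma C_k_on_Suc_imp: "C_k_on (Suc k) f S \<Longrightarrow> C_k_on k f S"
proof (induction k arbitrary: f)
  case 0
  then show ?case
    by (simp add: continuous_on_eq_continuous_within) (metis has_derivative_continuous)
next
  case (Suc k)
  then obtain f' where "\<forall>x\<in>S. (f has_derivative f' x) (at x within S)"
      "\<forall>v. C_k_on (Suc k) (\<lambda>x. f' x v) S"
    using C_k_on.simps(2) by blast
  with Suc.IH show ?case
    unfolding C_k_on.simps(2)[of k f] by blast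
qed

lemma C_k_on_const: "C_k_on k (\<lambda>x. c) S"
  by (induction k arbitrary: c) (auto intro!: exI[of _ "\<lambda>x v. 0"])

lemma C_k_on_add: "C_k_on k f S \<Longrightarrow> C_k_on k g S \<Longrightarrow> C_k_on k (\<lambda>x. f x + g x) S"
proof (induction k arbitrary: f g)
  case (Suc k)
  then obtain f' g' where "\<forall>x\<in>S. (f has_derivative f' x) (at x within S)"
      "\<forall>x\<in>S. (g has_derivative g' x) (at x within S)"
      "\<forall>v. C_k_on k (\<lambda>x. f' x v) S" "\<forall>v. C_k_on k (\<lambda>x. g' x v) S"
    by auto
  with Suc.IH show ?case
    by (simp, intro exI[of _ "\<lambda>x v. f' x v + g' x v"]) (simp add: has_derivative_add)
qed (simp add: continuous_on_add)

text \<open>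
  One induction covers products, inner products and scalar multiples. The Leibniz rule brings in
  the functions themselves next to their derivatives; this is why \<open>C_k_on_Suc_imp\<close> is needed.
\<close>

lemma (in bounded_bilinear) C_k_on:
  "C_k_on k f S \<Longrightarrow> C_k_on k g S \<Longrightarrow> C_k_on k (\<lambda>x. prod (f x) (g x)) S"
proof (induction k arbitrary: f g)
  case (Suc k)
  then obtain f' g' where d: "\<forall>x\<in>S. (f has_derivative f' x) (at x within S)"
      "\<forall>x\<in>S. (g has_derivative g' x) (at x within S)"
      "\<forall>v. C_k_on k (\<lambda>x. f' x v) S" "\<forall>v. C_k_on k (\<lambda>x. g' x v) S"
    by auto
  have "C_k_on k f S" "C_k_on k g S"
    using Suc.prems C_k_on_Suc_imp by blast+
  with d Suc.IH show ?case
    by (simp, intro exI[of _ "\<lambda>x v. prod (f x) (g' x v) + prod (f' x v) (g x)"])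
       (simp add: FDERIV C_k_on_add)
qed (simp add: continuous_on)

text \<open>
  The derivative of \<open>1/f\<close> is a polynomial in \<open>1/f\<close> and \<open>f'\<close>, so the induction hypothesis for
  \<open>1/f\<close> itself suffices. The square root works in the same way.
\<close>

lemma C_k_on_inverse:
  fixes f :: "'a::real_normed_vector \<Rightarrow> real"
  assumes "C_k_on k f S" and "\<And>x. x \<in> S \<Longrightarrow> f x \<noteq> 0"
  shows "C_k_on k (\<lambda>x. inverse (f x)) S"
  using assms(1)
proof (induction k)
  case 0
  then show ?case using assms(2) by (simp add: continuous_on_inverse)
next
  case (Suc k)
  obtain f' where d: "\<forall>x\<in>S. (f has_derivative f' x) (at x within S)"
      "\<forall>v. C_k_on k (\<lambda>x. f' x v) S"
    using Suc.prems by auto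
  have "C_k_on k (\<lambda>x. inverse (f x)) S"
    using Suc C_k_on_Suc_imp by blast
  with d(2) have "C_k_on k (\<lambda>x. (-1) * (inverse (f x) * f' x v * inverse (f x))) S" for v
    by (intro bounded_bilinear.C_k_on[OF bounded_bilinear_mult] C_k_on_const) auto
  with d(1) assms(2) show ?case
    by (simp, intro exI[of _ "\<lambda>x v. - (inverse (f x) * f' x v * inverse (f x))"])
       (simp add: has_derivative_inverse)
qed

lemma C_k_on_ln:
  fixes f :: "'a::real_normed_vector \<Rightarrow> real"
  assumes "C_k_on k f S" and pos: "\<And>x. x \<in> S \<Longrightarrow> f x > 0"
  shows "C_k_on k (\<lambda>x. ln (f x)) S"
proof (cases k)
  case 0
  then show ?thesis using assms(1) pos[THEN less_imp_neq] by (simp add: continuous_on_ln)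
next
  case (Suc m)
  then obtain f' where d: "\<forall>x\<in>S. (f has_derivative f' x) (at x within S)"
      "\<forall>v. C_k_on m (\<lambda>x. f' x v) S"
    using assms(1) by auto
  have "C_k_on m f S" using assms(1) Suc C_k_on_Suc_imp by blast
  then have "C_k_on m (\<lambda>x. f' x v * inverse (f x)) S" for v
    using d(2) pos by (intro bounded_bilinear.C_k_on[OF bounded_bilinear_mult] C_k_on_inverse) force+
  moreover have "((\<lambda>x. ln (f x)) has_derivative (\<lambda>v. f' x v * inverse (f x))) (at x within S)"
    if "x \<in> S" for x
    using has_derivative_ln[OF pos[OF that] d(1)[rule_format, OF that]] by (simp add: mult.commute)
  ultimately show ?thesis
    unfolding Suc C_k_on.simps(2) by (intro exI[of _ "\<lambda>x v. f' x v * inverse (f x)"]) simp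
qed

lemma C_k_on_sqrt:
  fixes f :: "'a::real_normed_vector \<Rightarrow> real"
  assumes "C_k_on k f S" and pos: "\<And>x. x \<in> S \<Longrightarrow> f x > 0"
  shows "C_k_on k (\<lambda>x. sqrt (f x)) S"
  using assms(1)
proof (induction k)
  case 0
  then show ?case by (simp add: continuous_on_real_sqrt)
next
  case (Suc k)
  obtain f' where d: "\<forall>x\<in>S. (f has_derivative f' x) (at x within S)"
      "\<forall>v. C_k_on k (\<lambda>x. f' x v) S"
    using Suc.prems by auto
  have "C_k_on k (\<lambda>x. sqrt (f x)) S"
    using Suc C_k_on_Suc_imp by blast
  with d(2) have "C_k_on k (\<lambda>x. f' x v * (inverse (sqrt (f x)) * (1/2))) S" for v
    using pos by (intro bounded_bilinear.C_k_on[OF bounded_bilinear_mult] C_k_on_const C_k_on_inverse) force+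
  moreover have "((\<lambda>x. sqrt (f x)) has_derivative (\<lambda>v. f' x v * (inverse (sqrt (f x)) * (1/2)))) (at x within S)"
    if "x \<in> S" for x
    using has_derivative_real_sqrt[OF pos[OF that] d(1)[rule_format, OF that]]
    by (simp add: field_simps)
  ultimately show ?case
    unfolding C_k_on.simps(2)
    by (intro exI[of _ "\<lambda>x v. f' x v * (inverse (sqrt (f x)) * (1/2))"]) simp
qed

text \<open>
  The derivative existentially quantified in \<open>C_k_on\<close> could a priori be a different one for each
  order. On an open set it is unique, hence equal to \<open>frechet_derivative\<close>, so a single derivative
  has all orders of differentiability.
\<close>

lemma smooth_on_derivative:
  assumes "smooth_on S f" and "open S"
  shows "x \<in> S \<Longrightarrow> (f has_derivative frechet_derivative f (at x)) (at x)"
    and "smooth_on S (\<lambda>x. frechet_derivative f (at x) v)"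
proof -
  show der: "(f has_derivative frechet_derivative f (at x)) (at x)" if "x \<in> S" for x
  proof -
    have "C_k_on (Suc 0) f S" using assms(1) smooth_on_def by blast
    then show ?thesis
      using that assms(2) by (metis C_k_on.simps(2) at_within_open differentiableI frechet_derivative_works)
  qed
  show "smooth_on S (\<lambda>x. frechet_derivative f (at x) v)"
    unfolding smooth_on_def
  proof
    fix k
    have "C_k_on (Suc k) f S" using assms(1) smooth_on_def by blast
    then obtain f' where d: "\<forall>x\<in>S. (f has_derivative f' x) (at x within S)"
      "\<forall>v. C_k_on k (\<lambda>x. f' x v) S"
      by auto
    have "f' x = frechet_derivative f (at x)" if "x \<in> S" for x
      using d(1) assms(2) that by (metis at_within_open frechet_derivative_at)
    then show "C_k_on k (\<lambda>x. frechet_derivative f (at x) v) S"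
      using C_k_on_cong_imp[OF d(2)[rule_format, of v]] by simp
  qed
qed

lemma smooth_on_imp_continuous_on: "smooth_on S f \<Longrightarrow> continuous_on S f"
  unfolding smooth_on_def using C_k_on.simps(1) by blast

lemma smooth_on_mult:
  fixes f g :: "real \<Rightarrow> real \<Rightarrow> real"
  assumes "smooth_on S (\<lambda>(t, u). f t u)" "smooth_on S (\<lambda>(t, u). g t u)"
  shows "smooth_on S (\<lambda>(t, u). f t u * g t u)"
  using assms bounded_bilinear.C_k_on[OF bounded_bilinear_mult, of _ "\<lambda>(t, u). f t u" S "\<lambda>(t, u). g t u"]
  by (simp add: smooth_on_def split_beta')

lemma smooth_on_add:
  assumes "smooth_on S (\<lambda>(t, u). f t u)" "smooth_on S (\<lambda>(t, u). g t u)"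
  shows "smooth_on S (\<lambda>(t, u). f t u + g t u)"
  using assms C_k_on_add[of _ "\<lambda>(t, u). f t u" S "\<lambda>(t, u). g t u"]
  by (simp add: smooth_on_def split_beta')

lemma smooth_on_inner:
  fixes f g :: "real \<Rightarrow> real \<Rightarrow> 'a::real_inner"
  assumes "smooth_on S (\<lambda>(t, u). f t u)" "smooth_on S (\<lambda>(t, u). g t u)"
  shows "smooth_on S (\<lambda>(t, u). f t u \<bullet> g t u)"
  using assms bounded_bilinear.C_k_on[OF bounded_bilinear_inner, of _ "\<lambda>(t, u). f t u" S "\<lambda>(t, u). g t u"]
  by (simp add: smooth_on_def split_beta')

lemma smooth_on_inverse:
  fixes f :: "real \<Rightarrow> real \<Rightarrow> real"
  assumes "smooth_on S (\<lambda>(t, u). f t u)" and "\<And>t u. (t, u) \<in> S \<Longrightarrow> f t u \<noteq> 0"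
  shows "smooth_on S (\<lambda>(t, u). inverse (f t u))"
  using assms C_k_on_inverse[of _ "\<lambda>(t, u). f t u" S]
  by (simp add: smooth_on_def split_beta')

lemma smooth_on_ln:
  fixes f :: "real \<Rightarrow> real \<Rightarrow> real"
  assumes "smooth_on S (\<lambda>(t, u). f t u)" and "\<And>t u. (t, u) \<in> S \<Longrightarrow> f t u > 0"
  shows "smooth_on S (\<lambda>(t, u). ln (f t u))"
  using assms C_k_on_ln[of _ "\<lambda>(t, u). f t u" S]
  by (simp add: smooth_on_def split_beta')

lemma smooth_on_sqrt:
  fixes f :: "real \<Rightarrow> real \<Rightarrow> real"
  assumes "smooth_on S (\<lambda>(t, u). f t u)" and "\<And>t u. (t, u) \<in> S \<Longrightarrow> f t u > 0"
  shows "smooth_on S (\<lambda>(t, u). sqrt (f t u))"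
  using assms C_k_on_sqrt[of _ "\<lambda>(t, u). f t u" S]
  by (simp add: smooth_on_def split_beta')

section \<open>Partial derivatives\<close>

definition Du :: "(real \<Rightarrow> real \<Rightarrow> 'a::real_normed_vector) \<Rightarrow> real \<Rightarrow> real \<Rightarrow> 'a" where
  "Du f t u = vector_derivative (f t) (at u)"

definition Dt :: "(real \<Rightarrow> real \<Rightarrow> 'a::real_normed_vector) \<Rightarrow> real \<Rightarrow> real \<Rightarrow> 'a" where
  "Dt f t u = vector_derivative (\<lambda>r. f r u) (at t)"

lemma smooth_on_partials:
  assumes f: "smooth_on U (\<lambda>(t, u). f t u)" and U: "open U"
  shows has_Du: "(t, u) \<in> U \<Longrightarrow> (f t has_vector_derivative Du f t u) (at u)"
    and has_Dt: "(t, u) \<in> U \<Longrightarrow> ((\<lambda>r. f r u) has_vector_derivative Dt f t u) (at t)"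
    and smooth_on_Du: "smooth_on U (\<lambda>(t, u). Du f t u)"
    and smooth_on_Dt: "smooth_on U (\<lambda>(t, u). Dt f t u)"
proof -
  let ?f = "\<lambda>(t, u). f t u"
  let ?d = "\<lambda>p. frechet_derivative ?f (at p)"
  have u: "(f t has_vector_derivative ?d (t, u) (0, 1)) (at u)" if "(t, u) \<in> U" for t u
  proof -
    have der: "((\<lambda>x. ?f (t, x)) has_derivative (\<lambda>h. ?d (t, u) (0, h))) (at u)"
      by (rule has_derivative_compose[of "\<lambda>x. (t, x)" "\<lambda>h. (0, h)" u UNIV ?f "?d (t, u)"])
         (auto intro!: derivative_eq_intros smooth_on_derivative(1)[OF f U that])
    have "?d (t, u) (0, h) = h *\<^sub>R ?d (t, u) (0, 1)" for h
      using has_derivative_linear[OF smooth_on_derivative(1)[OF f U that], THEN linear_cmul, of h "(0, 1)"]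
      by simp
    then have "(\<lambda>h. ?d (t, u) (0, h)) = (\<lambda>h. h *\<^sub>R ?d (t, u) (0, 1))"
      by (rule ext)
    then show ?thesis
      unfolding has_vector_derivative_def by (rule has_derivative_eq_rhs[OF der[unfolded prod.case]])
  qed
  have t: "((\<lambda>r. f r u) has_vector_derivative ?d (t, u) (1, 0)) (at t)" if "(t, u) \<in> U" for t u
  proof -
    have der: "((\<lambda>x. ?f (x, u)) has_derivative (\<lambda>h. ?d (t, u) (h, 0))) (at t)"
      by (rule has_derivative_compose[of "\<lambda>x. (x, u)" "\<lambda>h. (h, 0)" t UNIV ?f "?d (t, u)"])
         (auto intro!: derivative_eq_intros smooth_on_derivative(1)[OF f U that])
    have "?d (t, u) (h, 0) = h *\<^sub>R ?d (t, u) (1, 0)" for h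
      using has_derivative_linear[OF smooth_on_derivative(1)[OF f U that], THEN linear_cmul, of h "(1, 0)"]
      by simp
    then have "(\<lambda>h. ?d (t, u) (h, 0)) = (\<lambda>h. h *\<^sub>R ?d (t, u) (1, 0))"
      by (rule ext)
    then show ?thesis
      unfolding has_vector_derivative_def by (rule has_derivative_eq_rhs[OF der[unfolded prod.case]])
  qed
  have Du: "Du f t u = ?d (t, u) (0, 1)" and Dt: "Dt f t u = ?d (t, u) (1, 0)" if "(t, u) \<in> U" for t u
    unfolding Du_def Dt_def using u[OF that] t[OF that] by (simp_all add: vector_derivative_at)
  show "(t, u) \<in> U \<Longrightarrow> (f t has_vector_derivative Du f t u) (at u)"
    "(t, u) \<in> U \<Longrightarrow> ((\<lambda>r. f r u) has_vector_derivative Dt f t u) (at t)"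
    using u t Du Dt by simp_all
  have "C_k_on k (\<lambda>(t, u). Du f t u) U" for k
    using smooth_on_derivative(2)[OF f U, of "(0, 1)"] Du
      C_k_on_cong_imp[of k "\<lambda>p. ?d p (0, 1)" U "\<lambda>(t, u). Du f t u"]
    by (auto simp: smooth_on_def)
  moreover have "C_k_on k (\<lambda>(t, u). Dt f t u) U" for k
    using smooth_on_derivative(2)[OF f U, of "(1, 0)"] Dt
      C_k_on_cong_imp[of k "\<lambda>p. ?d p (1, 0)" U "\<lambda>(t, u). Dt f t u"]
    by (auto simp: smooth_on_def)
  ultimately show "smooth_on U (\<lambda>(t, u). Du f t u)" "smooth_on U (\<lambda>(t, u). Dt f t u)"
    unfolding smooth_on_def by blast+
qed

text \<open>
  The mean value theorem in the first variable, applied to \<open>f(\<cdot>, u + h) - f(\<cdot>, u)\<close>, and then in the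
  second variable. The second difference is symmetric in the two variables, so exchanging their
  roles gives the same value in terms of the other mixed derivative.
\<close>

lemma second_difference_mvt:
  fixes f g m :: "real \<Rightarrow> real \<Rightarrow> real"
  assumes h: "0 < h"
    and f: "\<And>r q. r \<in> {t..t + h} \<Longrightarrow> q \<in> {u..u + h} \<Longrightarrow> ((\<lambda>r. f r q) has_real_derivative g r q) (at r)"
    and g: "\<And>r q. r \<in> {t..t + h} \<Longrightarrow> q \<in> {u..u + h} \<Longrightarrow> (g r has_real_derivative m r q) (at q)"
  obtains r q where "r \<in> {t..t + h}" "q \<in> {u..u + h}"
    "f (t + h) (u + h) - f (t + h) u - f t (u + h) + f t u = h * h * m r q"
proof -
  have "\<exists>r>t. r < t + h \<and> (f (t + h) (u + h) - f (t + h) u) - (f t (u + h) - f t u)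
      = (t + h - t) * (g r (u + h) - g r u)"
    by (rule MVT2) (use h in \<open>auto intro!: DERIV_diff f\<close>)
  then obtain r where r: "t < r" "r < t + h"
    "(f (t + h) (u + h) - f (t + h) u) - (f t (u + h) - f t u) = h * (g r (u + h) - g r u)"
    by auto
  have "\<exists>q>u. q < u + h \<and> g r (u + h) - g r u = (u + h - u) * m r q"
    by (rule MVT2) (use h r in \<open>auto intro!: g\<close>)
  then obtain q where q: "u < q" "q < u + h" "g r (u + h) - g r u = h * m r q"
    by auto
  show ?thesis
    by (rule that[of r q]) (use r q in auto)
qed

lemma continuous_on_box_close:
  fixes a :: "real \<Rightarrow> real \<Rightarrow> real"
  assumes "continuous_on U (\<lambda>(t, u). a t u)" "open U" "(t, u) \<in> U" "0 < e"
  shows "\<forall>\<^sub>F h in at_right 0. \<forall>r\<in>{t..t + h}. \<forall>q\<in>{u..u + h}. (r, q) \<in> U \<and> \<bar>a r q - a t u\<bar> < e"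
proof -
  have "isCont (\<lambda>(t, u). a t u) (t, u)"
    using assms(1-3) continuous_on_eq_continuous_at by blast
  then have "((\<lambda>(t, u). a t u) \<longlongrightarrow> a t u) (nhds (t, u))"
    using tendsto_at_iff_tendsto_nhds[of "\<lambda>(t, u). a t u" "(t, u)"] by (simp add: isCont_def)
  then have "\<forall>\<^sub>F p in nhds (t, u). \<bar>a (fst p) (snd p) - a t u\<bar> < e"
    using assms(4) by (auto dest!: tendstoD[of _ _ _ e] simp: dist_real_def case_prod_beta)
  moreover have "\<forall>\<^sub>F p in nhds (t, u). p \<in> U"
    using assms(2,3) by (simp add: eventually_nhds_in_open)
  ultimately have "\<forall>\<^sub>F p in nhds t \<times>\<^sub>F nhds u. p \<in> U \<and> \<bar>a (fst p) (snd p) - a t u\<bar> < e"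
    unfolding nhds_prod by eventually_elim blast
  then obtain P Q where PQ: "eventually P (nhds t)" "eventually Q (nhds u)"
    "\<forall>x y. P x \<longrightarrow> Q y \<longrightarrow> (x, y) \<in> U \<and> \<bar>a x y - a t u\<bar> < e"
    by (auto simp: eventually_prod_filter)
  then obtain d1 d2 where d: "d1 > 0" "\<forall>x. dist x t < d1 \<longrightarrow> P x" "d2 > 0" "\<forall>x. dist x u < d2 \<longrightarrow> Q x"
    unfolding eventually_nhds_metric by blast
  have "\<forall>\<^sub>F h in at_right 0. h < min d1 d2"
    using d by (auto simp: eventually_at_right_field intro!: exI[of _ "min d1 d2"])
  then show ?thesis
    by eventually_elim (use d PQ(3) in \<open>auto simp: dist_real_def\<close>)
qed

text \<open>
  Both mixed derivatives, taken at suitable points of a small square with corner \<open>(t, u)\<close>, equal the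
  second difference divided by \<open>h\<^sup>2\<close>. Continuity lets the square shrink to its corner.
\<close>

lemma mixed_partials_commute_real:
  fixes f :: "real \<Rightarrow> real \<Rightarrow> real"
  assumes U: "open U" "(t, u) \<in> U"
    and f: "\<And>t u. (t, u) \<in> U \<Longrightarrow> ((\<lambda>r. f r u) has_real_derivative ft t u) (at t)"
      "\<And>t u. (t, u) \<in> U \<Longrightarrow> (f t has_real_derivative fu t u) (at u)"
    and ft: "\<And>t u. (t, u) \<in> U \<Longrightarrow> (ft t has_real_derivative ftu t u) (at u)"
    and fu: "\<And>t u. (t, u) \<in> U \<Longrightarrow> ((\<lambda>r. fu r u) has_real_derivative fut t u) (at t)"
    and cont: "continuous_on U (\<lambda>(t, u). ftu t u)" "continuous_on U (\<lambda>(t, u). fut t u)"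
  shows "fut t u = ftu t u"
proof (rule ccontr)
  assume ne: "fut t u \<noteq> ftu t u"
  define e where "e = \<bar>fut t u - ftu t u\<bar> / 2"
  have e: "e > 0" using ne by (simp add: e_def)
  define near where "near a h \<longleftrightarrow>
      (\<forall>r\<in>{t..t + h}. \<forall>q\<in>{u..u + h}. (r, q) \<in> U \<and> \<bar>a r q - a t u\<bar> < e)"
    for a :: "real \<Rightarrow> real \<Rightarrow> real" and h
  have "\<forall>\<^sub>F h in at_right 0. near fut h \<and> near ftu h \<and> 0 < h"
    unfolding near_def
    by (intro eventually_conj eventually_at_right_less continuous_on_box_close cont U e)
  then obtain h where "near fut h \<and> near ftu h \<and> 0 < h"
    using eventually_happens'[OF trivial_limit_at_right_real] by blast
  then have h: "near fut h" "near ftu h" "0 < h"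
    by auto
  have in_U: "(r, q) \<in> U" if "r \<in> {t..t + h}" "q \<in> {u..u + h}" for r q
    using h(1) that unfolding near_def by blast
  obtain r q where rq: "r \<in> {t..t + h}" "q \<in> {u..u + h}"
    "f (t + h) (u + h) - f (t + h) u - f t (u + h) + f t u = h * h * ftu r q"
    using second_difference_mvt[OF h(3), of t u f ft ftu] f(1)[OF in_U] ft[OF in_U] by metis
  obtain q' r' where rq': "q' \<in> {u..u + h}" "r' \<in> {t..t + h}"
    "f (t + h) (u + h) - f t (u + h) - f (t + h) u + f t u = h * h * fut r' q'"
    using second_difference_mvt[OF h(3), of u t "\<lambda>q r. f r q" "\<lambda>q r. fu r q" "\<lambda>q r. fut r q"]
      f(2)[OF in_U] fu[OF in_U] by metis
  have "h * h * ftu r q = h * h * fut r' q'"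
    using rq(3) rq'(3) by linarith
  then have "ftu r q = fut r' q'"
    using h(3) by simp
  moreover have "\<bar>ftu r q - ftu t u\<bar> < e" "\<bar>fut r' q' - fut t u\<bar> < e"
    using h(1,2) rq(1,2) rq'(1,2) unfolding near_def by blast+
  moreover have "2 * e = \<bar>fut t u - ftu t u\<bar>"
    by (simp add: e_def)
  ultimately show False by linarith
qed

text \<open>
  The vector-valued case follows from the real one by pairing with an arbitrary fixed vector.
\<close>

lemma mixed_partials_commute:
  fixes f :: "real \<Rightarrow> real \<Rightarrow> 'a::real_inner"
  assumes f: "smooth_on U (\<lambda>(t, u). f t u)" and U: "open U" "(t, u) \<in> U"
  shows "Dt (Du f) t u = Du (Dt f) t u"
proof -
  note sm = smooth_on_Du[OF f U(1)] smooth_on_Dt[OF f U(1)]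
  have lin: "((\<lambda>x. g x \<bullet> b) has_real_derivative g' \<bullet> b) (at x)"
    if "(g has_vector_derivative g') (at x)" for g :: "real \<Rightarrow> 'a" and g' x b
    using bounded_linear.has_vector_derivative[OF bounded_linear_inner_left that]
    by (simp add: has_real_derivative_iff_has_vector_derivative)
  have cont: "continuous_on U (\<lambda>(t, u). g t u \<bullet> b)"
    if "smooth_on U (\<lambda>(t, u). g t u)" for g :: "real \<Rightarrow> real \<Rightarrow> 'a" and b
    using continuous_on_inner[OF smooth_on_imp_continuous_on[OF that] continuous_on_const, of b]
    by (simp add: split_beta')
  have "Dt (Du f) t u \<bullet> b = Du (Dt f) t u \<bullet> b" for b
    by (rule mixed_partials_commute_real[OF U, where f = "\<lambda>t u. f t u \<bullet> b"
          and ft = "\<lambda>t u. Dt f t u \<bullet> b" and fu = "\<lambda>t u. Du f t u \<bullet> b"])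
       (intro lin cont has_Du[OF _ U(1)] has_Dt[OF _ U(1)] smooth_on_Du[OF _ U(1)]
          smooth_on_Dt[OF _ U(1)] f sm; assumption)+
  then show ?thesis
    using vector_eq_rdot by blast
qed

section \<open>A minimum principle on the circle\<close>

text \<open>
  If positivity fails, then by periodicity it fails in the compact set
  \<open>{a..b} \<times> {0..L}\<close>, where the closed set \<open>R \<le> 0\<close> contains a point with smallest time. Before that time \<open>R\<close>
  is positive, so by continuity \<open>R\<close> is nonnegative at that time. Such a first zero is excluded by
  the hypothesis \<open>no_first_zero\<close>, which is where a differential inequality for \<open>R\<close> is used.
\<close>

lemma periodic_positivity_persists:
  fixes R :: "real \<Rightarrow> real \<Rightarrow> real"
  assumes cont: "continuous_on ({a..b} \<times> UNIV) (\<lambda>(t, u). R t u)"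
    and L: "L > 0" and per: "\<And>t u. t \<in> {a..b} \<Longrightarrow> R t (u + L) = R t u"
    and init: "\<And>u. R a u > 0"
    and no_first_zero: "\<And>t u. a < t \<Longrightarrow> t \<le> b \<Longrightarrow> R t u = 0 \<Longrightarrow> (\<And>r x. a \<le> r \<Longrightarrow> r < t \<Longrightarrow> R r x > 0)
      \<Longrightarrow> (\<And>x. R t x \<ge> 0) \<Longrightarrow> False"
    and t: "t \<in> {a..b}"
  shows "R t u > 0"
proof (rule ccontr)
  assume neg: "\<not> R t u > 0"
  \<comment> \<open>Every value of \<open>R r\<close> is attained on one period: subtract \<open>\<lfloor>x / L\<rfloor>\<close> periods from \<open>x\<close>.\<close>
  have red: "\<exists>y\<in>{0..L}. R r y = R r x" if "r \<in> {a..b}" for r x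
  proof -
    interpret periodic_fun_simple "R r" L
      by standard (use per that in auto)
    have "0 \<le> L * frac (x / L)" "L * frac (x / L) \<le> L * 1"
      using L frac_lt_1[of "x / L"] by (auto intro!: mult_left_mono simp del: mult_1_right)
    moreover have "x - of_int \<lfloor>x / L\<rfloor> * L = L * frac (x / L)"
      using L by (simp add: frac_def field_simps)
    ultimately show ?thesis
      using minus_of_int[of x "\<lfloor>x / L\<rfloor>"] by (intro bexI[of _ "x - of_int \<lfloor>x / L\<rfloor> * L"]) auto
  qed
  define K where "K = {p \<in> {a..b} \<times> {0..L}. (\<lambda>(t, u). R t u) p \<le> 0}"
  have "closed K"
    unfolding K_def
    by (intro continuous_on_closed_Collect_le[OF continuous_on_subset[OF cont] continuous_on_const])
       (auto intro: closed_Times)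
  then have "compact K"
    using compact_Int_closed[OF compact_Times[of "{a..b}" "{0..L}"], of K]
    by (simp add: K_def Int_absorb1 Collect_conj_eq Int_assoc)
  moreover have "K \<noteq> {}"
    using neg red[OF t, of u] t by (force simp: K_def)
  moreover have "continuous_on K fst"
    by (intro continuous_on_fst continuous_on_id)
  ultimately obtain p where p: "p \<in> K" "\<And>q. q \<in> K \<Longrightarrow> fst p \<le> fst q"
    using continuous_attains_inf[of K fst] by blast
  obtain t0 u0 where p_eq: "p = (t0, u0)" by (cases p)
  have t0: "a \<le> t0" "t0 \<le> b" "R t0 u0 \<le> 0"
    using p(1) p_eq by (auto simp: K_def)
  have before: "R r x > 0" if "a \<le> r" "r < t0" for r x
  proof (rule ccontr)
    assume c: "\<not> R r x > 0"
    have "r \<in> {a..b}" using that t0 by auto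
    then obtain y where "y \<in> {0..L}" "R r y = R r x"
      using red by blast
    then have "(r, y) \<in> K" using c that t0 by (auto simp: K_def)
    then show False using p(2) p_eq that by fastforce
  qed
  have "a < t0"
    using init[of u0] t0 by (cases "a = t0") auto
  have at_t0: "R t0 x \<ge> 0" for x
  proof -
    have "continuous_on {a..b} (\<lambda>r. (r, x))"
      by (intro continuous_on_Pair continuous_on_id continuous_on_const)
    from continuous_on_compose2[OF cont this] have "continuous_on {a..b} (\<lambda>r. R r x)"
      by auto
    then have "continuous_on {a..t0} (\<lambda>r. R r x)"
      by (rule continuous_on_subset) (use t0 in auto)
    then have "((\<lambda>r. R r x) \<longlongrightarrow> R t0 x) (at_left t0)"
      by (rule continuous_on_Icc_at_leftD) (rule \<open>a < t0\<close>)
    moreover have "\<forall>\<^sub>F r in at_left t0. R r x \<ge> 0"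
      using eventually_at_left_real[OF \<open>a < t0\<close>]
      by eventually_elim (use before in \<open>auto intro!: less_imp_le\<close>)
    ultimately show ?thesis by (rule tendsto_lowerbound) simp
  qed
  show False
    by (rule no_first_zero[OF \<open>a < t0\<close> t0(2) _ before at_t0, of u0]) (use t0 at_t0[of u0] in auto)
qed

section \<open>The Harnack quantity\<close>

text \<open>
  The arc-length derivative of a curve whose speed is \<open>v\<close>, written for a whole family of curves.
\<close>

definition Ds :: "(real \<Rightarrow> real \<Rightarrow> real) \<Rightarrow> (real \<Rightarrow> real \<Rightarrow> real) \<Rightarrow> real \<Rightarrow> real \<Rightarrow> real" where
  "Ds v f t u = Du f t u * inverse (v t u)"

text \<open>
  The Harnack computation depends on the curve only through its speed \<open>v\<close> and curvature \<open>k\<close> and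
  their two evolution equations. Separating it from the geometry leaves a computation with real
  functions.
\<close>

locale curvature_evolution =
  fixes J :: "real set" and v k :: "real \<Rightarrow> real \<Rightarrow> real"
  assumes open_J: "open J"
    and smooth_v: "smooth_on (J \<times> UNIV) (\<lambda>(t, u). v t u)"
    and smooth_k: "smooth_on (J \<times> UNIV) (\<lambda>(t, u). k t u)"
    and v_pos: "\<And>t u. t \<in> J \<Longrightarrow> v t u > 0"
    and k_pos: "\<And>t u. t \<in> J \<Longrightarrow> k t u > 0"
    and v_t: "\<And>t u. t \<in> J \<Longrightarrow> Dt v t u = - (k t u)\<^sup>2 * v t u"
    and k_t: "\<And>t u. t \<in> J \<Longrightarrow> Dt k t u = Ds v (Ds v k) t u + (k t u) ^ 3 + k t u"
begin

abbreviation smooth :: "(real \<Rightarrow> real \<Rightarrow> real) \<Rightarrow> bool" where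
  "smooth f \<equiv> smooth_on (J \<times> UNIV) (\<lambda>(t, u). f t u)"

abbreviation D :: "(real \<Rightarrow> real \<Rightarrow> real) \<Rightarrow> real \<Rightarrow> real \<Rightarrow> real" where
  "D \<equiv> Ds v"

lemma open_domain: "open (J \<times> (UNIV :: real set))"
  using open_J by (simp add: open_Times)

lemma smooth_D:
  assumes "smooth f" shows "smooth (D f)"
proof -
  have "v t u \<noteq> 0" if "(t, u) \<in> J \<times> UNIV" for t u
    using v_pos[of t u] that by simp
  then show ?thesis
    unfolding Ds_def
    by (intro smooth_on_mult smooth_on_Du smooth_on_inverse assms smooth_v open_domain)
qed

lemma has_D:
  assumes "smooth f" "t \<in> J"
  shows "(f t has_real_derivative v t u * D f t u) (at u)"
  using has_Du[OF assms(1) open_domain, of t u] v_pos[OF assms(2), of u] assms(2)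
  by (simp add: has_real_derivative_iff_has_vector_derivative Ds_def field_simps)

lemma has_Dt_real:
  assumes "smooth f" "t \<in> J"
  shows "((\<lambda>r. f r u) has_real_derivative Dt f t u) (at t)"
  using has_Dt[OF assms(1) open_domain, of t u] assms(2)
  by (simp add: has_real_derivative_iff_has_vector_derivative)

lemma D_eqI:
  assumes "(f t has_real_derivative v t u * d) (at u)" "t \<in> J"
  shows "D f t u = d"
  using assms v_pos[of t u]
  by (simp add: Ds_def Du_def has_real_derivative_iff_has_vector_derivative vector_derivative_at)

lemma Dt_eqI:
  fixes f :: "real \<Rightarrow> real \<Rightarrow> real"
  assumes "((\<lambda>r. f r u) has_real_derivative d) (at t)"
  shows "Dt f t u = d"
  using assms by (simp add: Dt_def has_real_derivative_iff_has_vector_derivative vector_derivative_at)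

lemma D_cong:
  assumes "\<And>u. f t u = g t u" shows "D f t u = D g t u"
proof -
  have "f t = g t" using assms by (rule ext)
  then show ?thesis by (simp add: Ds_def Du_def)
qed

text \<open>
  The factor \<open>1/v\<close> in \<open>\<partial>\<^sub>s = v\<^sup>-\<^sup>1 \<partial>\<^sub>u\<close> grows at the rate \<open>k\<^sup>2\<close> because \<open>v\<close> decays at that rate, while
  \<open>\<partial>\<^sub>u\<close> commutes with \<open>\<partial>\<^sub>t\<close>.
\<close>

lemma commutator:
  assumes f: "smooth f" and t: "t \<in> J"
  shows "Dt (D f) t u = D (Dt f) t u + (k t u)\<^sup>2 * D f t u"
proof (rule Dt_eqI)
  have "((\<lambda>r. Du f r u) has_real_derivative Dt (Du f) t u) (at t)"
    by (rule has_Dt_real[OF smooth_on_Du[OF f open_domain] t])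
  moreover have "((\<lambda>r. v r u) has_real_derivative - (k t u)\<^sup>2 * v t u) (at t)"
    using has_Dt_real[OF smooth_v t, of u] v_t[OF t, of u] by simp
  ultimately have "((\<lambda>r. Du f r u * inverse (v r u)) has_real_derivative
      Dt (Du f) t u * inverse (v t u) + (k t u)\<^sup>2 * (Du f t u * inverse (v t u))) (at t)"
    using v_pos[OF t, of u]
    by (auto intro!: derivative_eq_intros simp: field_simps)
  moreover have "Dt (Du f) t u = Du (Dt f) t u"
    using mixed_partials_commute[OF f open_domain, of t u] t by simp
  ultimately show "((\<lambda>r. D f r u) has_real_derivative D (Dt f) t u + (k t u)\<^sup>2 * D f t u) (at t)"
    by (simp add: Ds_def)
qed

definition w :: "real \<Rightarrow> real \<Rightarrow> real" where
  "w = (\<lambda>t u. ln (k t u))"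

definition Q :: "real \<Rightarrow> real \<Rightarrow> real" where
  "Q = (\<lambda>t u. D (D w) t u + (k t u)\<^sup>2)"

lemma smooth_w: "smooth w"
  unfolding w_def using k_pos by (intro smooth_on_ln smooth_k) auto

lemma smooth_Q: "smooth Q"
  unfolding Q_def power2_eq_square
  by (intro smooth_on_add smooth_on_mult smooth_D smooth_w smooth_k)

lemma D_k:
  assumes t: "t \<in> J" shows "D k t u = k t u * D w t u"
proof -
  have "D w t u = D k t u / k t u"
    by (rule D_eqI) (use has_D[OF smooth_k t, of u] k_pos[OF t, of u] t in
      \<open>auto simp: w_def intro!: derivative_eq_intros\<close>)
  then show ?thesis using k_pos[OF t, of u] by (simp add: field_simps)
qed

lemma has_D_k: "t \<in> J \<Longrightarrow> (k t has_real_derivative v t u * (k t u * D w t u)) (at u)"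
  using has_D[OF smooth_k, of t u] D_k[of t u] by simp

lemma Dt_w:
  assumes t: "t \<in> J"
  shows "Dt w t u = D (D w) t u + (D w t u)\<^sup>2 + (k t u)\<^sup>2 + 1"
proof -
  have "D (D k) t u = D (\<lambda>t u. k t u * D w t u) t u"
    by (rule D_cong) (rule D_k[OF t])
  also have "\<dots> = k t u * ((D w t u)\<^sup>2 + D (D w) t u)"
    by (rule D_eqI[OF _ t]) (use has_D_k[OF t, of u] has_D[OF smooth_D[OF smooth_w] t, of u] in
      \<open>auto intro!: derivative_eq_intros simp: algebra_simps power2_eq_square\<close>)
  finally have *: "D (D k) t u = k t u * ((D w t u)\<^sup>2 + D (D w) t u)" .
  have "Dt w t u = Dt k t u / k t u"
    by (rule Dt_eqI) (use has_Dt_real[OF smooth_k t, of u] k_pos[OF t, of u] in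
      \<open>auto simp: w_def intro!: derivative_eq_intros\<close>)
  then have "k t u * Dt w t u = Dt k t u"
    using k_pos[OF t, of u] by simp
  then have "k t u * Dt w t u = k t u * (D (D w) t u + (D w t u)\<^sup>2 + (k t u)\<^sup>2 + 1)"
    using k_t[OF t, of u] *
    by (simp add: algebra_simps power2_eq_square power3_eq_cube)
  then show ?thesis using k_pos[OF t, of u] by simp
qed

text \<open>
  Write \<open>a, b, c, d\<close> for the first four arc-length derivatives of \<open>w\<close>. Since \<open>k\<^sub>s = k a\<close>, every
  quantity involved is a polynomial in \<open>k, a, b, c, d\<close>. Applying the commutator twice to the
  equation for \<open>w\<^sub>t\<close> gives \<open>a\<^sub>t\<close> and then \<open>b\<^sub>t\<close>, and both sides of the claim become the same
  polynomial.
\<close>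

lemma Q_evolution:
  assumes t: "t \<in> J"
  shows "Dt Q t u = D (D Q) t u + 2 * D w t u * D Q t u + 2 * (Q t u)\<^sup>2 + 2 * (k t u)\<^sup>2"
proof -
  define a where "a = D w"
  define b where "b = D a"
  define c where "c = D b"
  define d where "d = D c"
  have sm: "smooth a" "smooth b" "smooth c"
    unfolding a_def b_def c_def by (intro smooth_D smooth_w)+
  have der: "(a t has_real_derivative v t x * b t x) (at x)"
      "(b t has_real_derivative v t x * c t x) (at x)"
      "(c t has_real_derivative v t x * d t x) (at x)"
      "(k t has_real_derivative v t x * (k t x * a t x)) (at x)" if "t \<in> J" for t x
    using has_D[OF sm(1) that] has_D[OF sm(2) that] has_D[OF sm(3) that] has_D_k[OF that]
    unfolding a_def b_def c_def d_def by blast+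
  have w_t: "Dt w t x = b t x + (a t x)\<^sup>2 + (k t x)\<^sup>2 + 1" if "t \<in> J" for t x
    using Dt_w[OF that] by (simp add: a_def b_def)
  have a_t: "Dt a t x = c t x + 2 * a t x * b t x + 3 * (k t x)\<^sup>2 * a t x" if t: "t \<in> J" for t x
  proof -
    have "D (Dt w) t x = D (\<lambda>t x. b t x + (a t x)\<^sup>2 + (k t x)\<^sup>2 + 1) t x"
      by (rule D_cong) (rule w_t[OF t])
    also have "\<dots> = c t x + 2 * a t x * b t x + 2 * (k t x)\<^sup>2 * a t x"
      by (rule D_eqI[OF _ t]) (use der[OF t, of x] in
        \<open>auto intro!: derivative_eq_intros simp: algebra_simps power2_eq_square\<close>)
    finally show ?thesis
      using commutator[OF smooth_w t, of x] by (simp add: a_def)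
  qed
  have b_t: "Dt b t x = d t x + 2 * (b t x)\<^sup>2 + 2 * a t x * c t x + 6 * (k t x)\<^sup>2 * (a t x)\<^sup>2
      + 4 * (k t x)\<^sup>2 * b t x" if t: "t \<in> J" for t x
  proof -
    have "D (Dt a) t x = D (\<lambda>t x. c t x + 2 * a t x * b t x + 3 * (k t x)\<^sup>2 * a t x) t x"
      by (rule D_cong) (rule a_t[OF t])
    also have "\<dots> = d t x + 2 * (b t x)\<^sup>2 + 2 * a t x * c t x + 6 * (k t x)\<^sup>2 * (a t x)\<^sup>2
      + 3 * (k t x)\<^sup>2 * b t x"
      by (rule D_eqI[OF _ t]) (use der[OF t, of x] in
        \<open>auto intro!: derivative_eq_intros simp: algebra_simps power2_eq_square\<close>)
    finally show ?thesis
      using commutator[OF sm(1) t, of x] by (simp add: b_def)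
  qed
  have Q_s: "D Q t x = c t x + 2 * (k t x)\<^sup>2 * a t x" for x
    by (rule D_eqI[OF _ t]) (use der[OF t, of x] in
        \<open>auto intro!: derivative_eq_intros simp: Q_def a_def[symmetric] b_def[symmetric] algebra_simps power2_eq_square\<close>)
  have "D (D Q) t u = D (\<lambda>t x. c t x + 2 * (k t x)\<^sup>2 * a t x) t u"
    by (rule D_cong) (rule Q_s)
  also have "\<dots> = d t u + 4 * (k t u)\<^sup>2 * (a t u)\<^sup>2 + 2 * (k t u)\<^sup>2 * b t u"
    by (rule D_eqI[OF _ t]) (use der[OF t, of u] in
        \<open>auto intro!: derivative_eq_intros simp: algebra_simps power2_eq_square\<close>)
  finally have Q_ss: "D (D Q) t u = d t u + 4 * (k t u)\<^sup>2 * (a t u)\<^sup>2 + 2 * (k t u)\<^sup>2 * b t u" .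
  have "((\<lambda>r. ln (k r u)) has_real_derivative Dt k t u / k t u) (at t)"
    using has_Dt_real[OF smooth_k t, of u] k_pos[OF t, of u] by (auto intro!: derivative_eq_intros)
  then have "Dt w t u = Dt k t u / k t u"
    by (intro Dt_eqI) (simp add: w_def)
  then have "Dt k t u = k t u * (b t u + (a t u)\<^sup>2 + (k t u)\<^sup>2 + 1)"
    using w_t[OF t, of u] k_pos[OF t, of u] by (simp add: field_simps)
  then have "Dt Q t u = Dt b t u + 2 * (k t u)\<^sup>2 * (b t u + (a t u)\<^sup>2 + (k t u)\<^sup>2 + 1)"
    using has_Dt_real[OF sm(2) t, of u] has_Dt_real[OF smooth_k t, of u]
    by (intro Dt_eqI) (auto intro!: derivative_eq_intros simp: Q_def a_def[symmetric] b_def[symmetric] algebra_simps power2_eq_square)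
  moreover have "Q t u = b t u + (k t u)\<^sup>2" "D w t u = a t u"
    by (simp_all add: Q_def a_def b_def)
  ultimately show ?thesis
    unfolding Q_ss Q_s b_t[OF t]
    by (simp add: algebra_simps power2_eq_square)
qed

text \<open>
  At a first zero \<open>(t, u)\<close> of \<open>R = (t - a) Q + 1/2\<close> the terms of zeroth order cancel because
  \<open>(t - a) Q = - 1/2\<close> there, and \<open>(t - a) R\<^sub>t = (t - a)\<^sup>2 (Q\<^sub>s\<^sub>s + 2 k\<^sup>2)\<close> remains. This is positive at a
  spatial minimum of \<open>Q\<close>, but \<open>R\<^sub>t \<le> 0\<close> since \<open>R\<close> is positive before time \<open>t\<close>.
\<close>

lemma Q_Harnack:
  assumes sub: "{a..b} \<subseteq> J" and L: "L > 0" and per: "\<And>t u. t \<in> J \<Longrightarrow> Q t (u + L) = Q t u"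
    and t: "a < t" "t \<le> b"
  shows "Q t u + 1 / (2 * (t - a)) > 0"
proof -
  define R where "R t u = (t - a) * Q t u + 1 / 2" for t u
  have "R t u > 0"
  proof (rule periodic_positivity_persists[where R = R and a = a and b = b and L = L and t = t])
    have "continuous_on (J \<times> UNIV) (\<lambda>(t, u). Q t u)"
      by (rule smooth_on_imp_continuous_on[OF smooth_Q])
    then have "continuous_on ({a..b} \<times> UNIV) (\<lambda>(t, u). Q t u)"
      by (rule continuous_on_subset) (use sub in auto)
    then show "continuous_on ({a..b} \<times> UNIV) (\<lambda>(t, u). R t u)"
      unfolding R_def split_beta' by (intro continuous_intros)
    show "R t (u + L) = R t u" if "t \<in> {a..b}" for t u
      using per sub that unfolding R_def by (metis subsetD)
    show "R a u > 0" for u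
      by (simp add: R_def)
  next
    fix t u
    assume t: "a < t" "t \<le> b" and zero: "R t u = 0"
      and before: "\<And>r x. a \<le> r \<Longrightarrow> r < t \<Longrightarrow> R r x > 0" and min: "\<And>x. R t x \<ge> 0"
    have tJ: "t \<in> J" using sub t by auto
    have "(t - a) * Q t u \<le> (t - a) * Q t x" for x
      using min[of x] zero by (simp add: R_def)
    then have Q_min: "Q t u \<le> Q t x" for x
      using t by simp
    have Q_s: "D Q t u = 0"
      using DERIV_local_min[OF has_D[OF smooth_Q tJ], of 1 u] Q_min v_pos[OF tJ, of u] by simp
    \<comment> \<open>Otherwise \<open>Q\<^sub>s\<close> is negative just to the right of \<open>u\<close>, and \<open>Q\<close> falls below its minimum there.\<close>
    have Q_ss: "D (D Q) t u \<ge> 0"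
    proof (rule ccontr)
      assume "\<not> D (D Q) t u \<ge> 0"
      then have "v t u * D (D Q) t u < 0"
        using v_pos[OF tJ, of u] by (simp add: mult_pos_neg)
      then obtain e where e: "e > 0" "\<And>h. 0 < h \<Longrightarrow> h < e \<Longrightarrow> D Q t (u + h) < 0"
        using DERIV_neg_dec_right[OF has_D[OF smooth_D[OF smooth_Q] tJ, of u]] Q_s by auto
      have "\<exists>x>u. x < u + e / 2 \<and> Q t (u + e / 2) - Q t u = (u + e / 2 - u) * (v t x * D Q t x)"
        by (rule MVT2) (use e(1) has_D[OF smooth_Q tJ] in auto)
      then obtain x where x: "u < x" "x < u + e / 2"
        "Q t (u + e / 2) - Q t u = e / 2 * (v t x * D Q t x)"
        by auto
      have "D Q t x < 0" using e(2)[of "x - u"] x e(1) by simp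
      then have "e / 2 * (v t x * D Q t x) < 0"
        using e(1) v_pos[OF tJ, of x] by (simp add: mult_pos_neg)
      then show False using Q_min[of "u + e / 2"] x(3) by simp
    qed
    have R_t: "((\<lambda>r. R r u) has_real_derivative Q t u + (t - a) * Dt Q t u) (at t)"
      unfolding R_def using has_Dt_real[OF smooth_Q tJ, of u]
      by (auto intro!: derivative_eq_intros)
    have "Q t u + (t - a) * Dt Q t u \<le> 0"
    proof (rule ccontr)
      assume "\<not> Q t u + (t - a) * Dt Q t u \<le> 0"
      then obtain e where e: "e > 0" "\<And>h. 0 < h \<Longrightarrow> h < e \<Longrightarrow> R (t - h) u < R t u"
        using DERIV_pos_inc_left[OF R_t] by auto
      \<comment> \<open>An increment that is below \<open>e\<close> and keeps \<open>t - h\<close> above the initial time \<open>a\<close>.\<close>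
      define h where "h = min e (t - a) / 2"
      have "0 < h" "h < e" "a \<le> t - h" "t - h < t"
        using e(1) t by (auto simp: h_def min_def field_simps)
      then show False using e(2)[of h] before[of "t - h" u] zero by simp
    qed
    then have "(t - a) * (Q t u + (t - a) * Dt Q t u) \<le> 0"
      using t by (simp add: mult_nonneg_nonpos)
    moreover have "(t - a) * (Q t u + (t - a) * Dt Q t u)
      = (t - a)\<^sup>2 * (D (D Q) t u + 2 * (k t u)\<^sup>2) + (t - a) * Q t u * (1 + 2 * ((t - a) * Q t u))"
      using Q_evolution[OF tJ, of u] Q_s by (simp add: algebra_simps power2_eq_square)
    moreover have "(t - a) * Q t u = - 1 / 2"
      using zero by (simp add: R_def)
    moreover have "(t - a)\<^sup>2 * (D (D Q) t u + 2 * (k t u)\<^sup>2) > 0"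
      using t Q_ss k_pos[OF tJ, of u] by (intro mult_pos_pos add_nonneg_pos) auto
    ultimately show False by simp
  qed (use L t in auto)
  then have "R t u / (t - a) > 0"
    using t by simp
  moreover have "R t u / (t - a) = Q t u + 1 / (2 * (t - a))"
    using t by (simp add: R_def add_divide_distrib)
  ultimately show ?thesis by simp
qed

end

section \<open>Frame equations along the flow\<close>

lemma inner_constant_derivative:
  fixes f g :: "real \<Rightarrow> 'a::real_inner"
  assumes "(f has_vector_derivative f') (at x)" "(g has_vector_derivative g') (at x)"
    and "open S" "x \<in> S" "\<And>y. y \<in> S \<Longrightarrow> f y \<bullet> g y = c"
  shows "f x \<bullet> g' + f' \<bullet> g x = 0"
proof -
  have "((\<lambda>x. f x \<bullet> g x) has_vector_derivative f x \<bullet> g' + f' \<bullet> g x) (at x)"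
    by (rule bounded_bilinear.has_vector_derivative[OF bounded_bilinear_inner assms(1,2)])
  moreover have "((\<lambda>x. f x \<bullet> g x) has_vector_derivative 0) (at x)"
    by (rule has_vector_derivative_transform_within_open[OF has_vector_derivative_const[of c] assms(3,4)])
       (simp add: assms(5))
  ultimately show ?thesis
    by (rule vector_derivative_unique_at)
qed

text \<open>
  Three nonzero orthogonal vectors span the three-dimensional space, and the difference of the two
  sides is orthogonal to each of them, hence to itself.
\<close>

lemma orthogonal_frame_expansion:
  fixes e1 e2 e3 x :: "real^3"
  assumes orth: "e1 \<bullet> e2 = 0" "e1 \<bullet> e3 = 0" "e2 \<bullet> e3 = 0"
    and ne: "e1 \<noteq> 0" "e2 \<noteq> 0" "e3 \<noteq> 0"
  shows "x = (x \<bullet> e1 / (e1 \<bullet> e1)) *\<^sub>R e1 + (x \<bullet> e2 / (e2 \<bullet> e2)) *\<^sub>R e2 + (x \<bullet> e3 / (e3 \<bullet> e3)) *\<^sub>R e3"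
proof -
  define y where "y = x - ((x \<bullet> e1 / (e1 \<bullet> e1)) *\<^sub>R e1 + (x \<bullet> e2 / (e2 \<bullet> e2)) *\<^sub>R e2 + (x \<bullet> e3 / (e3 \<bullet> e3)) *\<^sub>R e3)"
  have sym: "e2 \<bullet> e1 = 0" "e3 \<bullet> e1 = 0" "e3 \<bullet> e2 = 0"
    using orth by (simp_all add: inner_commute)
  have y: "y \<bullet> e1 = 0" "y \<bullet> e2 = 0" "y \<bullet> e3 = 0"
    using orth sym ne by (simp_all add: y_def inner_diff_left inner_add_left)
  have distinct: "e1 \<noteq> e2" "e1 \<noteq> e3" "e2 \<noteq> e3"
    using orth ne by auto
  have "pairwise orthogonal {e1, e2, e3}"
    using orth by (auto simp: pairwise_def orthogonal_def inner_commute)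
  then have "independent {e1, e2, e3}"
    by (rule pairwise_orthogonal_independent) (use ne in auto)
  moreover have "card {e1, e2, e3} = DIM(real^3)"
    using distinct by simp
  ultimately have "span {e1, e2, e3} = (UNIV :: (real^3) set)"
    by (metis card_eq_dim dim_UNIV finite.emptyI finite_insert subset_UNIV top.extremum_uniqueI order_refl)
  then have "orthogonal y y"
    using orthogonal_to_span[of y "{e1, e2, e3}" y] y by (auto simp: orthogonal_def)
  then show ?thesis
    by (simp add: orthogonal_def y_def)
qed

lemma vector_derivative_periodic:
  fixes f :: "real \<Rightarrow> 'a::real_normed_vector"
  assumes "\<And>x. f (x + L) = f x"
  shows "vector_derivative f (at (x + L)) = vector_derivative f (at x)"
proof -
  have shift: "((\<lambda>x. f (x + c)) has_vector_derivative d) (at x)"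
    if "(f has_vector_derivative d) (at (x + c))" for c d x
    using vector_diff_chain_at[of "\<lambda>x. x + c" 1 x f d]
      has_vector_derivative_add[OF has_vector_derivative_id has_vector_derivative_const, of c "at x"] that
    by (simp add: o_def)
  have prev: "f (x + - L) = f x" for x
    using assms[of "x - L"] by simp
  have "(f has_vector_derivative d) (at (x + L)) \<longleftrightarrow> (f has_vector_derivative d) (at x)" for d
    using shift[of d x L] shift[of d "x + L" "- L"] assms prev by auto
  then show ?thesis
    by (simp add: vector_derivative_def)
qed

text \<open>
  The curve shortening flow on an open set of times, where all time derivatives are two-sided and
  mixed partial derivatives commute. Its consequences up to the evolution equations are local in
  the parameter.
\<close>

locale sphere_csf =
  fixes J :: "real set" and F N :: "real \<Rightarrow> real \<Rightarrow> real^3" and k :: "real \<Rightarrow> real \<Rightarrow> real"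
  defines "k \<equiv> \<lambda>t. geodesic_curvature (F t) (N t)"
  assumes open_J: "open J"
    and smooth_F: "smooth_on (J \<times> UNIV) (\<lambda>(t, u). F t u)"
    and smooth_N: "smooth_on (J \<times> UNIV) (\<lambda>(t, u). N t u)"
    and F_F: "\<And>t u. t \<in> J \<Longrightarrow> F t u \<bullet> F t u = 1"
    and immersed: "\<And>t u. t \<in> J \<Longrightarrow> Du F t u \<noteq> 0"
    and N_N: "\<And>t u. t \<in> J \<Longrightarrow> N t u \<bullet> N t u = 1"
    and N_F: "\<And>t u. t \<in> J \<Longrightarrow> N t u \<bullet> F t u = 0"
    and N_p: "\<And>t u. t \<in> J \<Longrightarrow> N t u \<bullet> Du F t u = 0"
    and flow: "\<And>t u. t \<in> J \<Longrightarrow> Dt F t u = k t u *\<^sub>R N t u"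
    and k_pos: "\<And>t u. t \<in> J \<Longrightarrow> k t u > 0"
begin

abbreviation "p \<equiv> Du F"

definition v :: "real \<Rightarrow> real \<Rightarrow> real" where "v = (\<lambda>t u. sqrt (p t u \<bullet> p t u))"

lemma open_domain: "open (J \<times> (UNIV :: real set))"
  using open_J by (simp add: open_Times)

lemma smooth_p: "smooth_on (J \<times> UNIV) (\<lambda>(t, u). p t u)"
  by (rule smooth_on_Du[OF smooth_F open_domain])

lemma p_p_pos: "t \<in> J \<Longrightarrow> p t u \<bullet> p t u > 0"
  using immersed by simp

lemma smooth_v: "smooth_on (J \<times> UNIV) (\<lambda>(t, u). v t u)"
  unfolding v_def by (intro smooth_on_sqrt smooth_on_inner smooth_p) (auto simp: immersed)

lemma v_pos: "t \<in> J \<Longrightarrow> v t u > 0"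
  unfolding v_def using p_p_pos by simp

lemma p_p: "p t u \<bullet> p t u = (v t u)\<^sup>2"
  by (simp add: v_def)

lemma v_norm: "v t u = norm (p t u)"
  by (simp add: v_def norm_eq_sqrt_inner)

lemma der_u:
  assumes "t \<in> J"
  shows "(F t has_vector_derivative p t u) (at u)"
    and "(N t has_vector_derivative Du N t u) (at u)"
    and "(p t has_vector_derivative Du p t u) (at u)"
    and "(v t has_real_derivative Du v t u) (at u)"
  using assms has_Du[OF smooth_F open_domain, of t u] has_Du[OF smooth_N open_domain, of t u]
    has_Du[OF smooth_p open_domain, of t u] has_Du[OF smooth_v open_domain, of t u]
  by (auto simp: has_real_derivative_iff_has_vector_derivative)

lemma der_t:
  assumes "t \<in> J"
  shows "((\<lambda>r. F r u) has_vector_derivative k t u *\<^sub>R N t u) (at t)"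
    and "((\<lambda>r. N r u) has_vector_derivative Dt N t u) (at t)"
    and "((\<lambda>r. p r u) has_vector_derivative Dt p t u) (at t)"
    and "((\<lambda>r. v r u) has_real_derivative Dt v t u) (at t)"
  using assms has_Dt[OF smooth_F open_domain, of t u] has_Dt[OF smooth_N open_domain, of t u]
    has_Dt[OF smooth_p open_domain, of t u] has_Dt[OF smooth_v open_domain, of t u] flow[OF assms, of u]
  by (auto simp: has_real_derivative_iff_has_vector_derivative)

lemma F_p:
  assumes t: "t \<in> J" shows "F t u \<bullet> p t u = 0"
  using inner_constant_derivative[OF der_u(1)[OF t] der_u(1)[OF t] open_UNIV, of u 1] F_F[OF t]
  by (simp add: inner_commute)

text \<open>
  Differentiating the constant inner products of \<open>F\<close>, \<open>F\<^sub>u\<close>, \<open>N\<close> and the identity \<open>F\<^sub>u \<bullet> F\<^sub>u = v\<^sup>2\<close>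
  along the curve gives every frame component of \<open>N\<^sub>u\<close> and \<open>F\<^sub>u\<^sub>u\<close> except their common normal part.
\<close>

lemma frame_derivatives:
  assumes t: "t \<in> J"
  shows "Du N t u \<bullet> F t u = 0" "Du N t u \<bullet> N t u = 0" "Du N t u \<bullet> p t u = - (N t u \<bullet> Du p t u)"
    "Du p t u \<bullet> F t u = - (v t u)\<^sup>2" "Du p t u \<bullet> p t u = v t u * Du v t u"
proof -
  show "Du N t u \<bullet> F t u = 0"
    using inner_constant_derivative[OF der_u(2)[OF t] der_u(1)[OF t] open_UNIV, of u 0] N_F[OF t] N_p[OF t]
    by simp
  show "Du N t u \<bullet> N t u = 0"
    using inner_constant_derivative[OF der_u(2)[OF t] der_u(2)[OF t] open_UNIV, of u 1] N_N[OF t]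
    by (simp add: inner_commute)
  show "Du N t u \<bullet> p t u = - (N t u \<bullet> Du p t u)"
    using inner_constant_derivative[OF der_u(2)[OF t] der_u(3)[OF t] open_UNIV, of u 0] N_p[OF t]
    by simp
  show "Du p t u \<bullet> F t u = - (v t u)\<^sup>2"
    using inner_constant_derivative[OF der_u(3)[OF t] der_u(1)[OF t] open_UNIV, of u 0] F_p[OF t] p_p
    by (simp add: inner_commute)
  have "((\<lambda>x. p t x \<bullet> p t x) has_real_derivative p t u \<bullet> Du p t u + Du p t u \<bullet> p t u) (at u)"
    using bounded_bilinear.has_vector_derivative[OF bounded_bilinear_inner der_u(3)[OF t] der_u(3)[OF t]]
    by (simp add: has_real_derivative_iff_has_vector_derivative)
  moreover have "((\<lambda>x. p t x \<bullet> p t x) has_real_derivative 2 * v t u * Du v t u) (at u)"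
    unfolding p_p using der_u(4)[OF t, of u] by (auto intro!: derivative_eq_intros)
  ultimately have "p t u \<bullet> Du p t u + Du p t u \<bullet> p t u = 2 * v t u * Du v t u"
    by (rule DERIV_unique)
  then show "Du p t u \<bullet> p t u = v t u * Du v t u"
    by (simp add: inner_commute)
qed

lemma frame_expansion:
  assumes t: "t \<in> J"
  shows "x = (x \<bullet> F t u) *\<^sub>R F t u + (x \<bullet> p t u / (v t u)\<^sup>2) *\<^sub>R p t u + (x \<bullet> N t u) *\<^sub>R N t u"
proof -
  have "F t u \<bullet> N t u = 0" "p t u \<bullet> N t u = 0"
    using N_F[OF t] N_p[OF t] by (simp_all add: inner_commute)
  moreover have "F t u \<noteq> 0" "N t u \<noteq> 0"
    using F_F[OF t, of u] N_N[OF t, of u] by auto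
  ultimately show ?thesis
    using orthogonal_frame_expansion[OF F_p[OF t, of u] _ _ _ immersed[OF t, of u], where x = x and ?e3.0 = "N t u"]
    unfolding F_F[OF t] N_N[OF t] p_p div_by_1 by blast
qed

lemma Du_p_expansion:
  assumes t: "t \<in> J"
  shows "Du p t u = - (v t u)\<^sup>2 *\<^sub>R F t u + (Du v t u / v t u) *\<^sub>R p t u + (Du p t u \<bullet> N t u) *\<^sub>R N t u"
proof -
  have "Du p t u = (Du p t u \<bullet> F t u) *\<^sub>R F t u + (Du p t u \<bullet> p t u / (v t u)\<^sup>2) *\<^sub>R p t u
      + (Du p t u \<bullet> N t u) *\<^sub>R N t u"
    by (rule frame_expansion[OF t])
  moreover have "v t u * Du v t u / (v t u)\<^sup>2 = Du v t u / v t u"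
    using v_pos[OF t, of u] by (simp add: power2_eq_square)
  ultimately show ?thesis
    unfolding frame_derivatives(4,5)[OF t] by metis
qed

text \<open>
  Inserting the frame expansion of \<open>F\<^sub>u\<^sub>u\<close> into \<open>\<tau>\<^sub>s\<close>, where \<open>\<tau> = F\<^sub>u / v\<close>, cancels the tangential
  part and leaves \<open>- F\<close> plus a normal vector; the covariant derivative drops the term \<open>- F\<close>. This
  also shows that the number in the definition of the curvature exists.
\<close>

lemma k_eq:
  assumes t: "t \<in> J"
  shows "k t u = (Du p t u \<bullet> N t u) / (v t u)\<^sup>2"
  unfolding k_def
proof (rule geodesic_curvature_eqI)
  have ut: "unit_tangent (F t) = (\<lambda>u. inverse (v t u) *\<^sub>R p t u)"
    by (auto simp: unit_tangent_def arclength_deriv_def Du_def v_norm)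
  have "((\<lambda>u. inverse (v t u) *\<^sub>R p t u) has_vector_derivative
      inverse (v t u) *\<^sub>R Du p t u + (- Du v t u / (v t u)\<^sup>2) *\<^sub>R p t u) (at u)"
    using der_u(3,4)[OF t, of u] v_pos[OF t, of u]
    by (auto intro!: derivative_eq_intros simp: power2_eq_square field_simps)
  then have "arclength_deriv (F t) (unit_tangent (F t)) u
      = inverse (v t u) *\<^sub>R (inverse (v t u) *\<^sub>R Du p t u + (- Du v t u / (v t u)\<^sup>2) *\<^sub>R p t u)"
    unfolding arclength_deriv_def ut using v_norm[of t u] by (simp add: vector_derivative_at Du_def)
  also have "\<dots> = - F t u + ((Du p t u \<bullet> N t u) / (v t u)\<^sup>2) *\<^sub>R N t u"
    by (subst Du_p_expansion[OF t])
       (use v_pos[OF t, of u] in \<open>simp add: algebra_simps power2_eq_square divide_inverse\<close>)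
  finally show "sphere_cov_deriv (F t) (unit_tangent (F t)) u = (Du p t u \<bullet> N t u / (v t u)\<^sup>2) *\<^sub>R N t u"
    by (simp add: sphere_cov_deriv_def inner_diff_left inner_add_left F_F[OF t] N_F[OF t])
  show "norm (N t u) = 1"
    using N_N[OF t] by (simp add: norm_eq_1)
qed

lemma Du_p_N: "t \<in> J \<Longrightarrow> Du p t u \<bullet> N t u = k t u * (v t u)\<^sup>2"
  using k_eq[of t u] v_pos[of t u] by simp

lemma smooth_k: "smooth_on (J \<times> UNIV) (\<lambda>(t, u). k t u)"
proof -
  have "smooth_on (J \<times> UNIV) (\<lambda>(t, u). (Du p t u \<bullet> N t u) * inverse (p t u \<bullet> p t u))"
    by (intro smooth_on_mult smooth_on_inverse smooth_on_inner smooth_p smooth_N smooth_on_Du open_domain)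
       (auto simp: immersed)
  moreover have "(Du p t u \<bullet> N t u) * inverse (p t u \<bullet> p t u) = k t u" if "t \<in> J" for t u
    using k_eq[OF that] by (simp add: p_p divide_inverse)
  ultimately show ?thesis
    unfolding smooth_on_def
    using C_k_on_cong_imp[of _ "\<lambda>(t, u). (Du p t u \<bullet> N t u) * inverse (p t u \<bullet> p t u)"
        "J \<times> UNIV" "\<lambda>(t, u). k t u"]
    by auto
qed

lemma Du_N:
  assumes t: "t \<in> J" shows "Du N t u = - k t u *\<^sub>R p t u"
proof -
  have "Du N t u = (Du N t u \<bullet> F t u) *\<^sub>R F t u + (Du N t u \<bullet> p t u / (v t u)\<^sup>2) *\<^sub>R p t u
      + (Du N t u \<bullet> N t u) *\<^sub>R N t u"
    by (rule frame_expansion[OF t])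
  also have "\<dots> = - k t u *\<^sub>R p t u"
    using frame_derivatives[OF t, of u] Du_p_N[OF t, of u] v_pos[OF t, of u]
    by (simp add: inner_commute)
  finally show ?thesis .
qed

lemma der_k:
  assumes "t \<in> J"
  shows "(k t has_real_derivative Du k t u) (at u)" "(Du k t has_real_derivative Du (Du k) t u) (at u)"
    "((\<lambda>r. k r u) has_real_derivative Dt k t u) (at t)"
  using assms has_Du[OF smooth_k open_domain, of t u] has_Dt[OF smooth_k open_domain, of t u]
    has_Du[OF smooth_on_Du[OF smooth_k open_domain] open_domain, of t u]
  by (auto simp: has_real_derivative_iff_has_vector_derivative)

section \<open>Evolution of speed and curvature\<close>

text \<open>
  \<open>F\<^sub>u\<^sub>t = F\<^sub>t\<^sub>u = (k N)\<^sub>u\<close>, and \<open>N\<^sub>u = - k F\<^sub>u\<close>.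
\<close>

lemma Dt_p:
  assumes t: "t \<in> J" shows "Dt p t u = Du k t u *\<^sub>R N t u - (k t u)\<^sup>2 *\<^sub>R p t u"
proof -
  have "Dt p t u = Du (Dt F) t u"
    using mixed_partials_commute[OF smooth_F open_domain] t by simp
  also have "\<dots> = vector_derivative (\<lambda>u. k t u *\<^sub>R N t u) (at u)"
  proof -
    have "Dt F t = (\<lambda>u. k t u *\<^sub>R N t u)"
      by (rule ext) (rule flow[OF t])
    then show ?thesis by (simp add: Du_def)
  qed
  also have "\<dots> = k t u *\<^sub>R Du N t u + Du k t u *\<^sub>R N t u"
    by (rule vector_derivative_at) (rule has_vector_derivative_scaleR[OF der_k(1)[OF t] der_u(2)[OF t]])
  finally show ?thesis
    by (simp add: Du_N[OF t] power2_eq_square)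
qed

lemma Dt_v:
  assumes t: "t \<in> J" shows "Dt v t u = - (k t u)\<^sup>2 * v t u"
proof -
  have "((\<lambda>r. p r u \<bullet> p r u) has_real_derivative p t u \<bullet> Dt p t u + Dt p t u \<bullet> p t u) (at t)"
    using bounded_bilinear.has_vector_derivative[OF bounded_bilinear_inner der_t(3)[OF t] der_t(3)[OF t]]
    by (simp add: has_real_derivative_iff_has_vector_derivative)
  moreover have "((\<lambda>r. p r u \<bullet> p r u) has_real_derivative 2 * v t u * Dt v t u) (at t)"
    unfolding p_p using der_t(4)[OF t, of u] by (auto intro!: derivative_eq_intros)
  ultimately have "p t u \<bullet> Dt p t u + Dt p t u \<bullet> p t u = 2 * v t u * Dt v t u"
    by (rule DERIV_unique)
  then have "2 * v t u * Dt v t u = p t u \<bullet> Dt p t u + Dt p t u \<bullet> p t u"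
    by simp
  also have "\<dots> = 2 * v t u * (- (k t u)\<^sup>2 * v t u)"
    using N_p[OF t, of u] by (simp add: Dt_p[OF t] inner_diff_left inner_diff_right inner_commute p_p power2_eq_square)
  finally show ?thesis
    unfolding mult_cancel_left using v_pos[OF t, of u] by auto
qed

text \<open>
  Both sides of \<open>F\<^sub>u\<^sub>u \<bullet> N = k v\<^sup>2\<close> are differentiated in time. On the left, \<open>F\<^sub>u\<^sub>u\<^sub>t\<close> is the
  \<open>u\<close>-derivative of lemma \<open>Dt_p\<close>, and the frame components of \<open>N\<^sub>t\<close> come from differentiating the inner
  products of \<open>N\<close> in time. The component \<open>N\<^sub>t \<bullet> F = - k\<close> meets the component \<open>- v\<^sup>2\<close> of \<open>F\<^sub>u\<^sub>u\<close> along
  \<open>F\<close>; this produces the curvature term \<open>k\<close> of the sphere.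
\<close>

lemma Dt_k:
  assumes t: "t \<in> J"
  shows "Dt k t u = Ds v (Ds v k) t u + (k t u) ^ 3 + k t u"
proof -
  have Dup: "((\<lambda>r. Du p r u) has_vector_derivative Dt (Du p) t u) (at t)"
    using has_Dt[OF smooth_on_Du[OF smooth_p open_domain] open_domain, of t u] t by simp
  have "Dt (Du p) t u = Du (Dt p) t u"
    using mixed_partials_commute[OF smooth_p open_domain] t by simp
  also have "\<dots> = vector_derivative (\<lambda>u. Du k t u *\<^sub>R N t u - (k t u)\<^sup>2 *\<^sub>R p t u) (at u)"
  proof -
    have "Dt p t = (\<lambda>u. Du k t u *\<^sub>R N t u - (k t u)\<^sup>2 *\<^sub>R p t u)"
      by (rule ext) (rule Dt_p[OF t])
    then show ?thesis by (simp add: Du_def)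
  qed
  also have "\<dots> = (Du k t u *\<^sub>R Du N t u + Du (Du k) t u *\<^sub>R N t u)
      - ((k t u)\<^sup>2 *\<^sub>R Du p t u + (2 * k t u * Du k t u) *\<^sub>R p t u)"
    by (rule vector_derivative_at)
       (intro has_vector_derivative_diff has_vector_derivative_scaleR der_k[OF t] der_u[OF t],
        use der_k(1)[OF t, of u] in \<open>auto intro!: derivative_eq_intros\<close>)
  finally have "Dt (Du p) t u \<bullet> N t u = Du (Du k) t u - (k t u) ^ 3 * (v t u)\<^sup>2"
    using N_N[OF t, of u] N_p[OF t, of u] frame_derivatives(2)[OF t, of u] Du_p_N[OF t, of u]
    by (simp add: inner_diff_right inner_add_right inner_commute power2_eq_square power3_eq_cube)
  moreover have "Du p t u \<bullet> Dt N t u = (v t u)\<^sup>2 * k t u - Du v t u * Du k t u / v t u"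
  proof -
    have "Dt N t u \<bullet> F t u = - k t u"
      using inner_constant_derivative[OF der_t(2)[OF t] der_t(1)[OF t] open_J t, of u u 0] N_F N_N[OF t]
      by simp
    moreover have "Dt N t u \<bullet> N t u = 0"
      using inner_constant_derivative[OF der_t(2)[OF t] der_t(2)[OF t] open_J t, of u u 1] N_N
      by (simp add: inner_commute)
    moreover have "Dt N t u \<bullet> p t u = - Du k t u"
      using inner_constant_derivative[OF der_t(2)[OF t] der_t(3)[OF t] open_J t, of u u 0] N_p N_p[OF t] N_N[OF t]
      by (simp add: Dt_p[OF t] inner_diff_right)
    ultimately show ?thesis
      by (subst Du_p_expansion[OF t]) (simp add: inner_add_right inner_diff_right inner_commute)
  qed
  moreover have "((\<lambda>r. Du p r u \<bullet> N r u) has_real_derivative Du p t u \<bullet> Dt N t u + Dt (Du p) t u \<bullet> N t u) (at t)"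
    using bounded_bilinear.has_vector_derivative[OF bounded_bilinear_inner Dup der_t(2)[OF t]]
    by (simp add: has_real_derivative_iff_has_vector_derivative)
  ultimately have "((\<lambda>r. Du p r u \<bullet> N r u) has_real_derivative
      (v t u)\<^sup>2 * k t u - Du v t u * Du k t u / v t u + (Du (Du k) t u - (k t u) ^ 3 * (v t u)\<^sup>2)) (at t)"
    by simp
  moreover have "((\<lambda>r. Du p r u \<bullet> N r u) has_real_derivative
      Dt k t u * (v t u)\<^sup>2 - 2 * (k t u) ^ 3 * (v t u)\<^sup>2) (at t)"
  proof (rule has_field_derivative_transform_within_open[OF _ open_J t])
    show "((\<lambda>r. k r u * (v r u)\<^sup>2) has_real_derivative Dt k t u * (v t u)\<^sup>2 - 2 * (k t u) ^ 3 * (v t u)\<^sup>2) (at t)"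
      using der_k(3)[OF t, of u] der_t(4)[OF t, of u]
      by (auto intro!: derivative_eq_intros simp: Dt_v[OF t] power2_eq_square power3_eq_cube algebra_simps)
  qed (simp add: Du_p_N)
  ultimately have eq: "(v t u)\<^sup>2 * k t u - Du v t u * Du k t u / v t u + (Du (Du k) t u - (k t u) ^ 3 * (v t u)\<^sup>2)
      = Dt k t u * (v t u)\<^sup>2 - 2 * (k t u) ^ 3 * (v t u)\<^sup>2"
    by (rule DERIV_unique)
  have "((\<lambda>u. Du k t u * inverse (v t u)) has_real_derivative
      Du (Du k) t u / v t u - Du k t u * Du v t u / (v t u)\<^sup>2) (at u)"
    using der_k(2)[OF t, of u] der_u(4)[OF t, of u] v_pos[OF t, of u]
    by (auto intro!: derivative_eq_intros simp: field_simps power2_eq_square)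
  then have "Du (Ds v k) t u = Du (Du k) t u / v t u - Du k t u * Du v t u / (v t u)\<^sup>2"
    unfolding Du_def[of "Ds v k"]
    by (intro vector_derivative_at) (simp add: Ds_def[abs_def] has_real_derivative_iff_has_vector_derivative)
  then have "(v t u)\<^sup>2 * Ds v (Ds v k) t u = Du (Du k) t u - Du v t u * Du k t u / v t u"
    using v_pos[OF t, of u] unfolding Ds_def[of v "Ds v k"] by (simp add: field_simps power2_eq_square)
  then have "(v t u)\<^sup>2 * Dt k t u = (v t u)\<^sup>2 * (Ds v (Ds v k) t u + (k t u) ^ 3 + k t u)"
    using eq by (simp add: algebra_simps)
  then show ?thesis using v_pos[OF t, of u] by simp
qed

sublocale curvature_evolution J v k
  by unfold_locales (rule open_J smooth_v smooth_k v_pos k_pos Dt_v Dt_k; assumption?)+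

text \<open>
  The family of functions \<open>Q\<close> is the quantity of the theorem, with the arc-length derivatives taken
  one curve at a time.
\<close>

lemma Q_arclength:
  "Q t u = arclength_deriv (F t) (arclength_deriv (F t) (\<lambda>x. ln (k t x))) u + (k t u)\<^sup>2"
proof -
  have arc: "arclength_deriv (F t) (f t) = Ds v f t" for f
    by (rule ext) (simp add: arclength_deriv_def Ds_def v_norm Du_def)
  have "(\<lambda>x. ln (k t x)) = w t"
    by (simp add: w_def)
  then show ?thesis
    by (simp only: arc Q_def)
qed

lemma Q_periodic:
  assumes "t \<in> J" "\<And>u. F t (u + L) = F t u" "\<And>u. N t (u + L) = N t u"
  shows "Q t (u + L) = Q t u"
proof -
  have p: "p t (u + L) = p t u" for u
    unfolding Du_def by (rule vector_derivative_periodic) (rule assms(2))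
  have v: "v t (u + L) = v t u" for u
    by (simp add: v_def p)
  have "Du p t (u + L) = Du p t u" for u
    unfolding Du_def[of p] by (rule vector_derivative_periodic) (rule p)
  then have k: "k t (u + L) = k t u" for u
    by (simp add: k_eq[OF assms(1)] v assms(3))
  have D: "D f t (u + L) = D f t u" if "\<And>u. f t (u + L) = f t u" for f u
    unfolding Ds_def v Du_def using vector_derivative_periodic[of "f t" L] that by simp
  have "D (D w) t (u + L) = D (D w) t u"
    by (rule D, rule D) (simp add: w_def k)
  then show ?thesis by (simp add: Q_def k)
qed

end

section \<open>The Harnack inequality\<close>

theorem theorem3p1:
  fixes \<alpha> :: real and F \<nu> :: "real \<Rightarrow> real \<Rightarrow> real^3"
    and \<kappa> :: "real \<Rightarrow> real \<Rightarrow> real"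
  defines "\<kappa> \<equiv> \<lambda>t. geodesic_curvature (F t) (\<nu> t)"
  assumes "\<alpha> < 0"
    and "closed_immersed_CSF {\<alpha>..<0} F \<nu>"
    and "\<forall>t\<in>{\<alpha>..<0}. \<forall>u. \<kappa> t u > 0"
  shows "\<forall>t\<in>{\<alpha><..<0}. \<forall>u.
           arclength_deriv (F t) (arclength_deriv (F t) (\<lambda>v. ln (\<kappa> t v))) u
             + (\<kappa> t u)\<^sup>2 + 1 / (2 * (t - \<alpha>)) \<ge> 0"
proof -
  have sub: "{\<alpha><..<0} \<times> UNIV \<subseteq> {\<alpha>..<0} \<times> (UNIV :: real set)"
    by auto
  note csf = assms(3)[unfolded closed_immersed_CSF_def closed_immersed_family_def unit_normal_field_def]
  interpret sphere_csf "{\<alpha><..<0}" F \<nu> \<kappa>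
  proof unfold_locales
    show "open {\<alpha><..<0}" by simp
    show "smooth_on ({\<alpha><..<0} \<times> UNIV) (\<lambda>(t, u). F t u)" "smooth_on ({\<alpha><..<0} \<times> UNIV) (\<lambda>(t, u). \<nu> t u)"
      using csf C_k_on_subset[OF _ sub] unfolding smooth_on_def by blast+
  next
    fix t u assume t: "t \<in> {\<alpha><..<0}"
    then have t': "t \<in> {\<alpha>..<0}" by simp
    have "norm (F t u) = 1" "norm (\<nu> t u) = 1"
      using csf t' by auto
    then show "F t u \<bullet> F t u = 1" "\<nu> t u \<bullet> \<nu> t u = 1"
      by (simp_all add: norm_eq_1)
    show imm: "Du F t u \<noteq> 0"
      using csf t' by (simp add: Du_def)
    show "\<nu> t u \<bullet> F t u = 0"
      using csf t' by blast
    have "\<nu> t u \<bullet> unit_tangent (F t) u = 0"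
      using csf t' by blast
    then show "\<nu> t u \<bullet> Du F t u = 0"
      using imm by (simp add: unit_tangent_def arclength_deriv_def Du_def)
    have "((\<lambda>r. F r u) has_vector_derivative \<kappa> t u *\<^sub>R \<nu> t u) (at t within {\<alpha><..<0})"
      unfolding \<kappa>_def
      by (rule has_vector_derivative_within_subset[of _ _ _ "{\<alpha>..<0}"]) (use csf t' in auto)
    then have "((\<lambda>r. F r u) has_vector_derivative \<kappa> t u *\<^sub>R \<nu> t u) (at t)"
      by (simp only: has_vector_derivative_within_open[OF t open_greaterThanLessThan])
    then show "Dt F t u = geodesic_curvature (F t) (\<nu> t) u *\<^sub>R \<nu> t u"
      unfolding \<kappa>_def by (simp add: Dt_def vector_derivative_at)
    show "geodesic_curvature (F t) (\<nu> t) u > 0"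
      using assms(4) t' unfolding \<kappa>_def by blast
  qed (rule \<kappa>_def)
  have per: "Q t (u + 2 * pi) = Q t u" if "t \<in> {\<alpha><..<0}" for t u
    by (rule Q_periodic[OF that]) (use csf that in auto)
  have "Q t u + 1 / (2 * (t - \<alpha>)) \<ge> 0" if t: "t \<in> {\<alpha><..<0}" for t u
  proof (rule tendsto_lowerbound)
    \<comment> \<open>The bound started at time \<open>a\<close> passes to the limit as \<open>a\<close> decreases to \<open>\<alpha>\<close>.\<close>
    show "((\<lambda>a. Q t u + 1 / (2 * (t - a))) \<longlongrightarrow> Q t u + 1 / (2 * (t - \<alpha>))) (at_right \<alpha>)"
      using t by (intro tendsto_intros) auto
    have "\<forall>\<^sub>F a in at_right \<alpha>. a \<in> {\<alpha><..<t}"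
      using t by (intro eventually_at_right_real) simp
    then show "\<forall>\<^sub>F a in at_right \<alpha>. 0 \<le> Q t u + 1 / (2 * (t - a))"
    proof (rule eventually_mono)
      fix a assume a: "a \<in> {\<alpha><..<t}"
      then have "Q t u + 1 / (2 * (t - a)) > 0"
        using t by (intro Q_Harnack[where b = t and L = "2 * pi"] per) auto
      then show "0 \<le> Q t u + 1 / (2 * (t - a))"
        by simp
    qed
  qed simp
  then show ?thesis
    by (simp add: Q_arclength)
qed

end
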